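(* Let $m_1<\dots<m_k<m_{k+1}=n$ with $m_i\mid m_{i+1}$, $L_i=m_i/m_{i-1}$ for $2\le i\le k+1$, and let $\mathcal{F}$ be the weaved flag $(\mathcal{F}^1_1,\dots,\mathcal{F}^1_{L_2-1},\dots,\mathcal{F}^k_1,\dots,\mathcal{F}^k_{L_{k+1}-1})$. Let $\beta\in\mathbb{F}_{q^n}^\ast\setminus\mathbb{F}_{q^{m_1}}^\ast$ and for $1\le i\le k$ set $M_i=\sum_{j=1}^{i-1}m_{j+1}(L_{j+1}-1)$. (1) If $\langle\beta\rangle\cap\mathbb{F}_{q^{m_1}}^\ast=\langle\beta\rangle\cap\mathbb{F}_{q^{m_k}}^\ast$, then $2m_k(L_{k+1}-1)+M_k\le d_f(\mathrm{Orb}_\beta(\mathcal{F}))\le m_k\lfloor L_{k+1}^2/2\rfloor+M_k$. (2) Otherwise, let $1<i\le k$ be minimal with $\langle\beta\rangle\cap\mathbb{F}_{q^{m_1}}^\ast\subsetneq\langle\beta\rangle\cap\mathbb{F}_{q^{m_i}}^\ast$. Then $2m_{i-1}(L_i-1)+M_{i-1}\le d_f(\mathrm{Orb}_\beta(\mathcal{F}))\le m_{i-1}\lfloor L_i^2/2\rfloor+M_{i-1}$.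
   Context: $q$ prime power; $\alpha$ primitive in $\mathbb{F}_{q^n}$; $\alpha_i=\alpha^{(q^n-1)/(q^{m_i}-1)}$; $\mathcal{F}^i_j=\bigoplus_{t=0}^{j-1}\mathbb{F}_{q^{m_i}}\alpha_{i+1}^t$ ($\mathbb{F}_q$-subspaces of $\mathbb{F}_{q^n}$) for $1\le i\le k$, $1\le j\le L_{i+1}-1$; the flag $\mathcal{F}$ has type $(m_1,\dots,m_2-m_1,m_2,\dots,m_k,\dots,n-m_k)$. $d_S(\mathcal{U},\mathcal{V})=\dim(\mathcal{U}+\mathcal{V})-\dim(\mathcal{U}\cap\mathcal{V})$; $d_f(\mathcal{F},\mathcal{F}')=\sum_i d_S(\mathcal{F}_i,\mathcal{F}'_i)$; for $\beta\in\mathbb{F}_{q^n}^\ast$ of multiplicative order $|\beta|$, $\mathcal{F}\beta=(\mathcal{F}_1\beta,\dots)$ and $\mathrm{Orb}_\beta(\mathcal{F})=\{\mathcal{F}\beta^j:0\le j<|\beta|\}$; the minimum distance of a flag code is the minimum $d_f$ between distinct codewords. *)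

theory Defs
  imports "HOL-Number_Theory.Number_Theory"
begin

text \<open>The field F_{q^n} is modelled by a finite field type 'a with CARD('a) = q^n.
  The subfield F_{q^m} is the set of roots of x^(q^m) - x.\<close>

definition subfld :: "nat \<Rightarrow> 'a::{field,finite} set" where
  "subfld Q = {x. x ^ Q = x}"

definition fq_span :: "nat \<Rightarrow> 'a::{field,finite} set \<Rightarrow> 'a set" where
  "fq_span q B = {(\<Sum>b\<in>B. c b * b) | c. \<forall>b\<in>B. c b \<in> subfld q}"

definition fq_dim :: "nat \<Rightarrow> 'a::{field,finite} set \<Rightarrow> nat" where
  "fq_dim q U = (LEAST d. \<exists>B. B \<subseteq> U \<and> card B = d \<and> fq_span q B = U)"

definition set_plus :: "'a::{field,finite} set \<Rightarrow> 'a set \<Rightarrow> 'a set" where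
  "set_plus U V = {u + v | u v. u \<in> U \<and> v \<in> V}"

definition subspace_dist :: "nat \<Rightarrow> 'a::{field,finite} set \<Rightarrow> 'a set \<Rightarrow> nat" where
  "subspace_dist q U V = fq_dim q (set_plus U V) - fq_dim q (U \<inter> V)"

definition flag_dist :: "nat \<Rightarrow> 'a::{field,finite} set list \<Rightarrow> 'a set list \<Rightarrow> nat" where
  "flag_dist q F G = (\<Sum>i<length F. subspace_dist q (F ! i) (G ! i))"

definition flag_mult :: "'a::{field,finite} set list \<Rightarrow> 'a \<Rightarrow> 'a set list" where
  "flag_mult F b = map (\<lambda>U. (\<lambda>x. x * b) ` U) F"

definition mult_order :: "'a::{field,finite} \<Rightarrow> nat" where
  "mult_order b = (LEAST d. 0 < d \<and> b ^ d = 1)"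

definition orbit :: "'a::{field,finite} \<Rightarrow> 'a set list \<Rightarrow> 'a set list set" where
  "orbit b F = {flag_mult F (b ^ j) | j. j < mult_order b}"

definition min_dist :: "nat \<Rightarrow> 'a::{field,finite} set list set \<Rightarrow> nat" where
  "min_dist q C = Min {flag_dist q F G | F G. F \<in> C \<and> G \<in> C \<and> F \<noteq> G}"

definition cyc_group :: "'a::{field,finite} \<Rightarrow> 'a set" where
  "cyc_group b = {b ^ j | j. True}"

definition alph :: "nat \<Rightarrow> nat \<Rightarrow> (nat \<Rightarrow> nat) \<Rightarrow> 'a::{field,finite} \<Rightarrow> nat \<Rightarrow> 'a" where
  "alph q n m \<alpha> i = \<alpha> ^ ((q ^ n - 1) div (q ^ (m i) - 1))"

definition Fij :: "nat \<Rightarrow> nat \<Rightarrow> (nat \<Rightarrow> nat) \<Rightarrow> 'a::{field,finite} \<Rightarrow> nat \<Rightarrow> nat \<Rightarrow> 'a set" where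
  "Fij q n m \<alpha> i j = {(\<Sum>t<j. c t * alph q n m \<alpha> (Suc i) ^ t) | c. \<forall>t<j. c t \<in> subfld (q ^ m i)}"

definition Lq :: "(nat \<Rightarrow> nat) \<Rightarrow> nat \<Rightarrow> nat" where
  "Lq m i = m i div m (i - 1)"

definition weaved_flag :: "nat \<Rightarrow> nat \<Rightarrow> (nat \<Rightarrow> nat) \<Rightarrow> nat \<Rightarrow> 'a::{field,finite} \<Rightarrow> 'a set list" where
  "weaved_flag q n m k \<alpha> =
     concat (map (\<lambda>i. map (\<lambda>j. Fij q n m \<alpha> i j) [1..<Lq m (Suc i)]) [1..<Suc k])"

definition Mq :: "(nat \<Rightarrow> nat) \<Rightarrow> nat \<Rightarrow> nat" where
  "Mq m i = (\<Sum>j=1..i-1. m (j+1) * (Lq m (j+1) - 1))"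

end

(* For b of F_{q^n}^* let F_{q^{m_s}} be the largest field of the tower m_1 < ... < m_{k+1} that does
   not contain b. The subspaces of the flag above that level are stable under b. Those below it lie
   in a field of the tower not containing b, so they meet their translates trivially and contribute
   exactly M_s. At level s itself, F^s_j is spanned over F_{q^{m_s}} by 1, ..., gamma^{j-1} for a
   generator gamma of F_{q^{m_{s+1}}}^*, and such a space is never stable under b; hence it
   contributes between 2 m_s and 2 m_s min(j, L_{s+1} - j). The distance of two codewords depends
   only on the quotient of the two multipliers, and the lower bounds increase with s. Dimensions are
   computed from card U = q^(dim U). *)

theory Submission
  imports Defs
begin

section \<open>Subspaces over a subfield\<close>

text \<open>The flag distance is measured over F_q, while the spaces of level i are best described
  over F_{q^{m_i}}, where \<open>Fij\<close> with index j has dimension j. Each level is analysed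
  over its own scalars, and passing back to F_q multiplies its distances by m_i. This explains the
  constants. The sum of 2j over 0 < j < L_{i+1} is L_{i+1} (L_{i+1} - 1), and m_i L_{i+1} = m_{i+1}
  turns it into a summand of M. The sum of 2 min(j, L - j) is floor(L^2 / 2), and L - 1 terms of at
  least 2 give the lower bound. Both cases are instances of one statement, in which s is the lowest
  level of a quotient of multipliers outside F_{q^{m_1}}: s = k with \<beta> itself as witness in
  case (1), s = i - 1 with a witness taken from the strict inclusion in case (2).\<close>

lemma set_plusI: "u \<in> U \<Longrightarrow> v \<in> V \<Longrightarrow> u + v \<in> set_plus U V"
  unfolding set_plus_def by blast

lemma set_plusE:
  assumes "w \<in> set_plus U V" obtains u v where "u \<in> U" "v \<in> V" "w = u + v"
  using assms unfolding set_plus_def by blast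

text \<open>A subfield enters only as the fixed points of an additive Q-th power map, together with
  their number. The same theory can then be used with F_q and with every field of the tower as
  scalars.\<close>

locale frobenius_subfield =
  fixes Q :: nat and K :: "'a::{field,finite} set"
  assumes K_eq: "K = subfld Q"
    and frob_add: "\<And>x y::'a. (x + y) ^ Q = x ^ Q + y ^ Q"
    and card_K: "card K = Q"
begin

lemma K_iff: "x \<in> K \<longleftrightarrow> x ^ Q = x"
  unfolding K_eq subfld_def by simp

lemma one_in_K: "1 \<in> K"
  by (simp add: K_iff)

lemma Q_pos: "Q > 0"
  using card_K one_in_K by (metis card_gt_0_iff empty_iff finite)

lemma zero_in_K: "0 \<in> K"
  using Q_pos by (simp add: K_iff)

lemma Q_gt_1: "Q > 1"
proof -
  have "card {0, 1::'a} \<le> card K"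
    using zero_in_K one_in_K by (intro card_mono) auto
  then show ?thesis using card_K by simp
qed

lemma K_add: "x \<in> K \<Longrightarrow> y \<in> K \<Longrightarrow> x + y \<in> K"
  by (simp add: K_iff frob_add)

lemma K_mult: "x \<in> K \<Longrightarrow> y \<in> K \<Longrightarrow> x * y \<in> K"
  by (simp add: K_iff power_mult_distrib)

lemma K_inverse: "x \<in> K \<Longrightarrow> inverse x \<in> K"
  by (simp add: K_iff power_inverse)

lemma K_uminus: "x \<in> K \<Longrightarrow> - x \<in> K"
proof -
  \<comment> \<open>Additivity at x and -x replaces a case distinction on the parity of Q.\<close>
  have "x ^ Q + (- x) ^ Q = 0"
    using frob_add[of x "- x"] Q_pos by (simp add: zero_power)
  then show "x \<in> K \<Longrightarrow> - x \<in> K"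
    by (simp add: K_iff add_eq_0_iff)
qed

lemma K_diff: "x \<in> K \<Longrightarrow> y \<in> K \<Longrightarrow> x - y \<in> K"
  using K_add[of x "- y"] K_uminus[of y] by simp

definition subsp :: "'a set \<Rightarrow> bool" where
  "subsp U \<longleftrightarrow> 0 \<in> U \<and> (\<forall>x\<in>U. \<forall>y\<in>U. x + y \<in> U) \<and> (\<forall>c\<in>K. \<forall>x\<in>U. c * x \<in> U)"

lemma subsp_0: "subsp U \<Longrightarrow> 0 \<in> U"
  and subsp_add: "subsp U \<Longrightarrow> x \<in> U \<Longrightarrow> y \<in> U \<Longrightarrow> x + y \<in> U"
  and subsp_scale: "subsp U \<Longrightarrow> c \<in> K \<Longrightarrow> x \<in> U \<Longrightarrow> c * x \<in> U"
  unfolding subsp_def by blast+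

lemma subsp_uminus: "subsp U \<Longrightarrow> x \<in> U \<Longrightarrow> - x \<in> U"
  using subsp_scale[of U "- 1" x] K_uminus[OF one_in_K] by simp

lemma subsp_diff: "subsp U \<Longrightarrow> x \<in> U \<Longrightarrow> y \<in> U \<Longrightarrow> x - y \<in> U"
  using subsp_add[of U x "- y"] subsp_uminus[of U y] by simp

lemma subsp_sum: "subsp U \<Longrightarrow> (\<And>i. i \<in> I \<Longrightarrow> f i \<in> U) \<Longrightarrow> sum f I \<in> U"
  by (induction I rule: infinite_finite_induct) (auto intro: subsp_0 subsp_add)

lemma subsp_Int: "subsp U \<Longrightarrow> subsp V \<Longrightarrow> subsp (U \<inter> V)"
  unfolding subsp_def by blast

lemma subsp_set_plus:
  assumes "subsp U" "subsp V" shows "subsp (set_plus U V)"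
  unfolding subsp_def
proof (intro conjI ballI)
  show "0 \<in> set_plus U V"
    using set_plusI[OF subsp_0[OF assms(1)] subsp_0[OF assms(2)]] by simp
next
  fix x y assume "x \<in> set_plus U V" "y \<in> set_plus U V"
  then obtain u v u' v' where uv: "u \<in> U" "v \<in> V" "x = u + v" "u' \<in> U" "v' \<in> V" "y = u' + v'"
    by (metis set_plusE)
  then have "(u + u') + (v + v') \<in> set_plus U V"
    using assms by (intro set_plusI subsp_add)
  then show "x + y \<in> set_plus U V" using uv by (simp add: algebra_simps)
next
  fix c x assume c: "c \<in> K" and "x \<in> set_plus U V"
  then obtain u v where uv: "u \<in> U" "v \<in> V" "x = u + v" by (metis set_plusE)
  then have "c * u + c * v \<in> set_plus U V"
    using assms c by (intro set_plusI subsp_scale)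
  then show "c * x \<in> set_plus U V" using uv by (simp add: algebra_simps)
qed

lemma subsp_mult_right:
  assumes "subsp U" shows "subsp ((\<lambda>x. x * b) ` U)"
  unfolding subsp_def
proof (intro conjI ballI)
  show "0 \<in> (\<lambda>x. x * b) ` U" using subsp_0[OF assms] by force
next
  fix x y assume "x \<in> (\<lambda>x. x * b) ` U" "y \<in> (\<lambda>x. x * b) ` U"
  then obtain u v where "u \<in> U" "v \<in> U" "x = u * b" "y = v * b" by auto
  then show "x + y \<in> (\<lambda>x. x * b) ` U"
    using subsp_add[OF assms, of u v] by (intro image_eqI[of _ _ "u + v"]) (simp_all add: distrib_right)
next
  fix c x assume c: "c \<in> K" and "x \<in> (\<lambda>x. x * b) ` U"
  then obtain u where "u \<in> U" "x = u * b" by auto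
  then show "c * x \<in> (\<lambda>x. x * b) ` U"
    using subsp_scale[OF assms c, of u] by (intro image_eqI[of _ _ "c * u"]) (simp_all add: mult.assoc)
qed

lemma subsp_K: "subsp K"
  unfolding subsp_def using zero_in_K K_add K_mult by blast

section \<open>Generating sets, dimension and cardinality\<close>

lemma fq_span_mem:
  assumes "\<forall>b\<in>B. c b \<in> K" shows "(\<Sum>b\<in>B. c b * b) \<in> fq_span Q B"
  using assms unfolding fq_span_def K_eq by blast

text \<open>A subspace of a finite field is a finite generating set of itself, so the LEAST in
  \<open>fq_dim\<close> ranges over a nonempty set.\<close>

lemma fq_span_self:
  assumes U: "subsp U" shows "fq_span Q U = U"
proof
  show "fq_span Q U \<subseteq> U"
  proof
    fix x assume "x \<in> fq_span Q U"
    then obtain c where c: "\<forall>b\<in>U. c b \<in> K" "x = (\<Sum>b\<in>U. c b * b)"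
      unfolding fq_span_def K_eq by blast
    show "x \<in> U" unfolding c(2) using c(1) by (intro subsp_sum[OF U] subsp_scale[OF U]) auto
  qed
next
  show "U \<subseteq> fq_span Q U"
  proof
    fix x assume "x \<in> U"
    have "(\<Sum>b\<in>U. (if b = x then 1 else 0) * b) = x"
      using \<open>x \<in> U\<close> by (simp add: if_distrib [of "\<lambda>a. a * _"] sum.delta cong: if_cong)
    moreover have "\<forall>b\<in>U. (if b = x then 1 else 0) \<in> K"
      using zero_in_K one_in_K by simp
    ultimately show "x \<in> fq_span Q U"
      using fq_span_mem[of U "\<lambda>b. if b = x then 1 else 0"] by simp
  qed
qed

lemma fq_dim_witness:
  assumes U: "subsp U"
  obtains B where "B \<subseteq> U" "card B = fq_dim Q U" "fq_span Q B = U"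
proof -
  have "\<exists>d B. B \<subseteq> U \<and> card B = d \<and> fq_span Q B = U"
    using fq_span_self[OF U] by blast
  then have "\<exists>B. B \<subseteq> U \<and> card B = fq_dim Q U \<and> fq_span Q B = U"
    unfolding fq_dim_def by (rule LeastI_ex)
  then show thesis using that by blast
qed

lemma fq_dim_le: "B \<subseteq> U \<Longrightarrow> fq_span Q B = U \<Longrightarrow> fq_dim Q U \<le> card B"
  unfolding fq_dim_def by (rule Least_le) blast

text \<open>A linear relation can be solved for any \<open>b0\<close> with nonzero coefficient. It
  follows that a generating set of least size is linearly independent.\<close>

lemma fq_span_remove:
  assumes b0: "b0 \<in> B" and e: "\<forall>b\<in>B. e b \<in> K" "e b0 \<noteq> 0" "(\<Sum>b\<in>B. e b * b) = 0"
  shows "fq_span Q (B - {b0}) = fq_span Q B"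
proof
  show "fq_span Q (B - {b0}) \<subseteq> fq_span Q B"
  proof
    fix x assume "x \<in> fq_span Q (B - {b0})"
    then obtain c where c: "\<forall>b\<in>B - {b0}. c b \<in> K" "x = (\<Sum>b\<in>B - {b0}. c b * b)"
      unfolding fq_span_def K_eq by blast
    have "(\<Sum>b\<in>B. (if b = b0 then 0 else c b) * b)
        = (\<Sum>b\<in>B - {b0}. (if b = b0 then 0 else c b) * b)"
      by (subst sum.remove[OF finite b0]) simp
    also have "\<dots> = x" unfolding c(2) by (rule sum.cong) simp_all
    finally have "(\<Sum>b\<in>B. (if b = b0 then 0 else c b) * b) = x" .
    moreover have "\<forall>b\<in>B. (if b = b0 then 0 else c b) \<in> K"
      using c(1) zero_in_K by simp
    ultimately show "x \<in> fq_span Q B"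
      using fq_span_mem[of B "\<lambda>b. if b = b0 then 0 else c b"] by simp
  qed
next
  define g where "g b = - (inverse (e b0) * e b)" for b
  have g: "\<forall>b\<in>B. g b \<in> K"
    using e(1) b0 unfolding g_def by (auto intro!: K_uminus K_mult K_inverse)
  have "e b0 * b0 = - (\<Sum>b\<in>B - {b0}. e b * b)"
    using e(3) sum.remove[OF finite b0, of "\<lambda>b. e b * b"] by (simp add: eq_neg_iff_add_eq_0)
  then have "inverse (e b0) * (e b0 * b0) = inverse (e b0) * - (\<Sum>b\<in>B - {b0}. e b * b)"
    by simp
  then have b0_eq: "b0 = (\<Sum>b\<in>B - {b0}. g b * b)"
    using e(2) unfolding g_def
    by (simp add: sum_distrib_left sum_negf mult.assoc[symmetric])
  show "fq_span Q B \<subseteq> fq_span Q (B - {b0})"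
  proof
    fix x assume "x \<in> fq_span Q B"
    then obtain c where c: "\<forall>b\<in>B. c b \<in> K" "x = (\<Sum>b\<in>B. c b * b)"
      unfolding fq_span_def K_eq by blast
    have "x = c b0 * b0 + (\<Sum>b\<in>B - {b0}. c b * b)"
      unfolding c(2) by (rule sum.remove[OF finite b0])
    also have "c b0 * b0 = (\<Sum>b\<in>B - {b0}. c b0 * g b * b)"
      by (subst b0_eq) (simp add: sum_distrib_left mult.assoc)
    finally have "x = (\<Sum>b\<in>B - {b0}. (c b0 * g b + c b) * b)"
      by (simp add: sum.distrib algebra_simps)
    moreover have "\<forall>b\<in>B - {b0}. c b0 * g b + c b \<in> K"
      using c(1) g b0 by (auto intro!: K_add K_mult)
    ultimately show "x \<in> fq_span Q (B - {b0})"
      using fq_span_mem[of "B - {b0}" "\<lambda>b. c b0 * g b + c b"] by simp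
  qed
qed

text \<open>For a generating set \<open>B\<close> of least size the coefficient map from
  \<open>B \<rightarrow>\<^sub>E K\<close> to \<open>U\<close> is a bijection.\<close>

lemma card_subsp:
  assumes U: "subsp U" shows "card U = Q ^ fq_dim Q U"
proof -
  obtain B where B: "B \<subseteq> U" "card B = fq_dim Q U" "fq_span Q B = U"
    using fq_dim_witness[OF U] .
  define \<phi> where "\<phi> c = (\<Sum>b\<in>B. c b * b)" for c :: "'a \<Rightarrow> 'a"
  have inj: "inj_on \<phi> (B \<rightarrow>\<^sub>E K)"
  proof (rule inj_onI, rule ccontr)
    fix c c' assume c: "c \<in> B \<rightarrow>\<^sub>E K" "c' \<in> B \<rightarrow>\<^sub>E K" "\<phi> c = \<phi> c'" "c \<noteq> c'"
    obtain b0 where b0: "b0 \<in> B" "c b0 \<noteq> c' b0" using c by (metis PiE_ext)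
    \<comment> \<open>Two coefficient functions with the same value differ by a relation that is
      nonzero at \<open>b0\<close>, so \<open>b0\<close> could be dropped from \<open>B\<close>,
      against minimality.\<close>
    have "\<forall>b\<in>B. c b - c' b \<in> K" using c by (auto intro!: K_diff)
    moreover have "(\<Sum>b\<in>B. (c b - c' b) * b) = 0"
      using c(3) unfolding \<phi>_def by (simp add: sum_subtractf algebra_simps)
    ultimately have "fq_span Q (B - {b0}) = U"
      using fq_span_remove[OF b0(1), of "\<lambda>b. c b - c' b"] b0(2) B(3) by simp
    then have "fq_dim Q U \<le> card (B - {b0})"
      using B(1) by (intro fq_dim_le) auto
    also have "\<dots> < card B" using b0(1) by (intro card_Diff1_less) auto
    finally show False using B(2) by simp
  qed
  have "\<phi> ` (B \<rightarrow>\<^sub>E K) = U"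
  proof
    show "\<phi> ` (B \<rightarrow>\<^sub>E K) \<subseteq> U"
      unfolding B(3)[symmetric] \<phi>_def by (auto intro!: fq_span_mem)
    show "U \<subseteq> \<phi> ` (B \<rightarrow>\<^sub>E K)"
    proof
      fix x assume "x \<in> U"
      then obtain c where c: "\<forall>b\<in>B. c b \<in> K" "x = (\<Sum>b\<in>B. c b * b)"
        unfolding B(3)[symmetric] fq_span_def K_eq by blast
      have "x = \<phi> (restrict c B)" unfolding \<phi>_def c(2) by (auto intro!: sum.cong)
      moreover have "restrict c B \<in> B \<rightarrow>\<^sub>E K" using c(1) by auto
      ultimately show "x \<in> \<phi> ` (B \<rightarrow>\<^sub>E K)" by blast
    qed
  qed
  then have "card U = card (B \<rightarrow>\<^sub>E K)" using card_image[OF inj] by simp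
  then show ?thesis using B(2) card_K by (simp add: card_funcsetE)
qed

lemma fq_dim_eqI: "subsp U \<Longrightarrow> card U = Q ^ d \<Longrightarrow> fq_dim Q U = d"
  using card_subsp[of U] Q_gt_1 by (metis power_inject_exp)

lemma fq_dim_zero: "fq_dim Q {0 :: 'a} = 0"
  by (rule fq_dim_eqI) (auto simp: subsp_def)

lemma fq_dim_mono: "subsp U \<Longrightarrow> subsp V \<Longrightarrow> U \<subseteq> V \<Longrightarrow> fq_dim Q U \<le> fq_dim Q V"
  using card_mono[of V U] Q_gt_1 by (simp add: card_subsp)

lemma fq_dim_strict_mono: "subsp U \<Longrightarrow> subsp V \<Longrightarrow> U \<subset> V \<Longrightarrow> fq_dim Q U < fq_dim Q V"
  using psubset_card_mono[of V U] Q_gt_1 by (simp add: card_subsp)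

lemma fq_dim_mult_right:
  assumes "subsp U" "b \<noteq> 0" shows "fq_dim Q ((\<lambda>x. x * b) ` U) = fq_dim Q U"
proof (rule fq_dim_eqI)
  show "subsp ((\<lambda>x. x * b) ` U)" using assms(1) by (rule subsp_mult_right)
  have "inj_on (\<lambda>x. x * b) U" using assms(2) by (auto intro: inj_onI)
  then show "card ((\<lambda>x. x * b) ` U) = Q ^ fq_dim Q U"
    using card_subsp[OF assms(1)] by (simp add: card_image)
qed

text \<open>Addition maps U x V onto the sum, and each fibre is a translate of the
  intersection.\<close>

lemma card_set_plus:
  assumes U: "subsp U" and V: "subsp V"
  shows "card (set_plus U V) * card (U \<inter> V) = card U * card V"
proof -
  have "\<forall>w. \<exists>u v. w \<in> set_plus U V \<longrightarrow> u \<in> U \<and> v \<in> V \<and> w = u + v"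
    by (metis set_plusE)
  then obtain f g where fg: "\<And>w. w \<in> set_plus U V \<Longrightarrow> f w \<in> U \<and> g w \<in> V \<and> w = f w + g w"
    by metis
  \<comment> \<open>A chosen decomposition w = f w + g w serves as base point of the fibre over w;
    the other decompositions arise by moving an element x of the intersection from one summand to
    the other.\<close>
  have "bij_betw (\<lambda>(w, x). (f w + x, g w - x)) (set_plus U V \<times> (U \<inter> V)) (U \<times> V)"
    unfolding bij_betw_def
  proof
    show "inj_on (\<lambda>(w, x). (f w + x, g w - x)) (set_plus U V \<times> (U \<inter> V))"
    proof (rule inj_onI, clarify)
      fix w x w' x' assume *: "w \<in> set_plus U V" "w' \<in> set_plus U V"
        "f w + x = f w' + x'" "g w - x = g w' - x'"
      have "w = (f w + x) + (g w - x)" using fg[OF *(1)] by simp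
      also have "\<dots> = w'" unfolding *(3,4) using fg[OF *(2)] by simp
      finally show "w = w' \<and> x = x'" using *(3) by simp
    qed
    show "(\<lambda>(w, x). (f w + x, g w - x)) ` (set_plus U V \<times> (U \<inter> V)) = U \<times> V"
    proof
      show "(\<lambda>(w, x). (f w + x, g w - x)) ` (set_plus U V \<times> (U \<inter> V)) \<subseteq> U \<times> V"
        using fg by (auto intro!: subsp_add[OF U] subsp_diff[OF V])
      show "U \<times> V \<subseteq> (\<lambda>(w, x). (f w + x, g w - x)) ` (set_plus U V \<times> (U \<inter> V))"
      proof clarify
        fix u v assume uv: "u \<in> U" "v \<in> V"
        define w where "w = u + v"
        have w: "w \<in> set_plus U V" unfolding w_def using uv by (rule set_plusI)
        have eq: "u - f w = g w - v"
          using fg[OF w] unfolding w_def by (simp add: algebra_simps)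
        have "u - f w \<in> U \<inter> V"
          using subsp_diff[OF U uv(1), of "f w"] subsp_diff[OF V _ uv(2), of "g w"] fg[OF w] eq
          by auto
        moreover have "v = g w - (u - f w)" unfolding eq by simp
        then have "(u, v) = (f w + (u - f w), g w - (u - f w))" by simp
        ultimately show "(u, v) \<in> (\<lambda>(w, x). (f w + x, g w - x)) ` (set_plus U V \<times> (U \<inter> V))"
          using w by (intro image_eqI[of _ _ "(w, u - f w)"]) simp_all
      qed
    qed
  qed
  from bij_betw_same_card[OF this] show ?thesis by (simp add: card_cartesian_product)
qed

lemma fq_dim_set_plus:
  assumes U: "subsp U" and V: "subsp V"
  shows "fq_dim Q (set_plus U V) + fq_dim Q (U \<inter> V) = fq_dim Q U + fq_dim Q V"
  using card_set_plus[OF assms] Q_gt_1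
  by (simp add: card_subsp subsp_set_plus subsp_Int U V power_add[symmetric])

lemma subspace_dist_self: "subsp U \<Longrightarrow> subspace_dist Q U U = 0"
  using fq_dim_set_plus[of U U] unfolding subspace_dist_def by simp

lemma subspace_dist_mult_right:
  assumes U: "subsp U" and V: "subsp V" and b: "b \<noteq> 0"
  shows "subspace_dist Q ((\<lambda>x. x * b) ` U) ((\<lambda>x. x * b) ` V) = subspace_dist Q U V"
proof -
  have 1: "set_plus ((\<lambda>x. x * b) ` U) ((\<lambda>x. x * b) ` V) = (\<lambda>x. x * b) ` set_plus U V"
  proof
    show "set_plus ((\<lambda>x. x * b) ` U) ((\<lambda>x. x * b) ` V) \<subseteq> (\<lambda>x. x * b) ` set_plus U V"
      by (auto elim!: set_plusE simp: distrib_right[symmetric] intro!: imageI set_plusI)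
    show "(\<lambda>x. x * b) ` set_plus U V \<subseteq> set_plus ((\<lambda>x. x * b) ` U) ((\<lambda>x. x * b) ` V)"
      by (auto elim!: set_plusE simp: distrib_right intro!: set_plusI)
  qed
  have 2: "((\<lambda>x. x * b) ` U) \<inter> ((\<lambda>x. x * b) ` V) = (\<lambda>x. x * b) ` (U \<inter> V)"
    using b by auto
  show ?thesis unfolding subspace_dist_def 1 2
    by (simp add: fq_dim_mult_right subsp_set_plus subsp_Int U V b)
qed

end

text \<open>Counting elements over both fields gives q^d = (q^e)^d', hence d = e * d' for every
  subspace involved. This is the source of the factor m_i in the contribution of level i.\<close>

lemma subspace_dist_scale:
  assumes "frobenius_subfield q K0" "frobenius_subfield (q ^ e) K"
    and U: "frobenius_subfield.subsp K0 U" "frobenius_subfield.subsp K U"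
    and V: "frobenius_subfield.subsp K0 V" "frobenius_subfield.subsp K V"
  shows "subspace_dist q U V = e * subspace_dist (q ^ e) U V"
proof -
  interpret k: frobenius_subfield q K0 by fact
  interpret K: frobenius_subfield "q ^ e" K by fact
  have "fq_dim q W = e * fq_dim (q ^ e) W" if "k.subsp W" "K.subsp W" for W
    using K.card_subsp[OF that(2)] that(1) by (intro k.fq_dim_eqI) (auto simp: power_mult)
  then show ?thesis unfolding subspace_dist_def
    using U V by (simp add: k.subsp_set_plus K.subsp_set_plus k.subsp_Int K.subsp_Int diff_mult_distrib2)
qed

section \<open>One level of the weaved flag\<close>

text \<open>One step of the tower: the extension W of K has degree L, expressed by its number of
  elements Q^L, and \<gamma> generates its multiplicative group.\<close>

locale weave_level = frobenius_subfield Q K + W: frobenius_subfield "Q ^ L" W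
  for Q :: nat and K :: "'a::{field,finite} set" and L :: nat and W :: "'a set" +
  fixes \<gamma> :: 'a
  assumes W_gen: "W - {0} = range (\<lambda>r. \<gamma> ^ r)"
begin

lemma K_subset_W: "K \<subseteq> W"
proof
  fix x assume "x \<in> K"
  then have "x ^ (Q ^ r) = x" for r
    by (induction r) (auto simp: K_iff power_mult)
  then show "x \<in> W" by (simp add: W.K_iff)
qed

lemma subsp_W: "subsp W"
  unfolding subsp_def using W.zero_in_K W.K_add W.K_mult K_subset_W by blast

lemma fq_dim_W: "fq_dim Q W = L"
  by (intro fq_dim_eqI subsp_W W.card_K)

lemma gamma_power_in_W: "\<gamma> ^ r \<in> W"
  using W_gen by blast

lemma gamma_nonzero: "\<gamma> \<noteq> 0"
proof -
  have "\<gamma> ^ 1 \<in> W - {0}" unfolding W_gen by blast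
  then show ?thesis by simp
qed

text \<open>The values at \<gamma> of the polynomials over K of degree below j; for consecutive
  fields of the tower this is \<open>Fij\<close>.\<close>

definition S :: "nat \<Rightarrow> 'a set" where
  "S j = {(\<Sum>t<j. c t * \<gamma> ^ t) | c. \<forall>t<j. c t \<in> K}"

lemma S_0: "S 0 = {0}"
  unfolding S_def by simp

lemma S_Suc: "S (Suc j) = set_plus (S j) ((\<lambda>x. x * \<gamma> ^ j) ` K)"
proof
  show "S (Suc j) \<subseteq> set_plus (S j) ((\<lambda>x. x * \<gamma> ^ j) ` K)"
    unfolding S_def by (auto intro!: set_plusI)
  show "set_plus (S j) ((\<lambda>x. x * \<gamma> ^ j) ` K) \<subseteq> S (Suc j)"
  proof
    fix w assume "w \<in> set_plus (S j) ((\<lambda>x. x * \<gamma> ^ j) ` K)"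
    then obtain c a where c: "\<forall>t<j. c t \<in> K" "a \<in> K" "w = (\<Sum>t<j. c t * \<gamma> ^ t) + a * \<gamma> ^ j"
      unfolding S_def by (auto elim!: set_plusE)
    have "w = (\<Sum>t<Suc j. (c(j := a)) t * \<gamma> ^ t)"
      unfolding c(3) by simp
    moreover have "\<forall>t<Suc j. (c(j := a)) t \<in> K" using c by (simp add: less_Suc_eq)
    ultimately show "w \<in> S (Suc j)" unfolding S_def by blast
  qed
qed

lemma subsp_S: "subsp (S j)"
proof (induction j)
  case 0 then show ?case by (simp add: S_0 subsp_def)
next
  case (Suc j) then show ?case
    unfolding S_Suc by (intro subsp_set_plus subsp_mult_right subsp_K)
qed

lemma S_SucI: "u \<in> S j \<Longrightarrow> a \<in> K \<Longrightarrow> u + a * \<gamma> ^ j \<in> S (Suc j)"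
  unfolding S_Suc by (intro set_plusI) auto

lemma S_SucE:
  assumes "w \<in> S (Suc j)" obtains u a where "u \<in> S j" "a \<in> K" "w = u + a * \<gamma> ^ j"
  using assms unfolding S_Suc by (auto elim!: set_plusE)

lemma S_mono: "i \<le> j \<Longrightarrow> S i \<subseteq> S j"
proof (induction rule: dec_induct)
  case (step n)
  have "S n \<subseteq> S (Suc n)" using S_SucI[OF _ zero_in_K] by fastforce
  then show ?case using step.IH by blast
qed simp

lemma S_1: "S 1 = K"
proof -
  have "w \<in> S (Suc 0) \<longleftrightarrow> w \<in> K" for w
    using S_SucI[of 0 0 w] by (auto elim!: S_SucE simp: S_0)
  then show ?thesis by auto
qed

lemma S_subset_W: "S j \<subseteq> W"
proof (induction j)
  case 0 then show ?case using W.zero_in_K by (simp add: S_0)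
next
  case (Suc j) then show ?case
    using gamma_power_in_W K_subset_W by (auto elim!: S_SucE intro!: W.K_add W.K_mult)
qed

lemma S_mult_gamma: "u \<in> S j \<Longrightarrow> u * \<gamma> \<in> S (Suc j)"
proof (induction j arbitrary: u)
  case 0 then show ?case using subsp_0[OF subsp_S] by (simp add: S_0)
next
  case (Suc j)
  from Suc.prems obtain v a where v: "v \<in> S j" "a \<in> K" "u = v + a * \<gamma> ^ j" by (rule S_SucE)
  have "v * \<gamma> + a * \<gamma> ^ Suc j \<in> S (Suc (Suc j))"
    using Suc.IH[OF v(1)] v(2) by (rule S_SucI)
  then show ?case unfolding v(3) by (simp add: algebra_simps)
qed

lemma S_mult_gamma_power: "u \<in> S j \<Longrightarrow> u * \<gamma> ^ r \<in> S (j + r)"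
proof (induction r)
  case (Suc r)
  then have "(u * \<gamma> ^ r) * \<gamma> \<in> S (Suc (j + r))" by (intro S_mult_gamma)
  then show ?case by (simp add: algebra_simps)
qed simp

lemma one_in_S: "0 < j \<Longrightarrow> 1 \<in> S j"
  using S_mono[of 1 j] one_in_K unfolding S_1 by auto

lemma gamma_power_in_S: "r < j \<Longrightarrow> \<gamma> ^ r \<in> S j"
  using S_mult_gamma_power[OF one_in_S[of 1], of r] S_mono[of "1 + r" j] by auto

lemma fq_dim_K: "fq_dim Q K = 1"
  by (rule fq_dim_eqI) (simp_all add: subsp_K card_K)

lemma fq_dim_S_le: "fq_dim Q (S j) \<le> j"
proof (induction j)
  case 0 then show ?case by (simp add: S_0 fq_dim_zero)
next
  case (Suc j)
  have "fq_dim Q (S (Suc j)) \<le> fq_dim Q (S j) + fq_dim Q ((\<lambda>x. x * \<gamma> ^ j) ` K)"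
    unfolding S_Suc using fq_dim_set_plus[OF subsp_S subsp_mult_right[OF subsp_K]]
    by (metis le_add1)
  also have "\<dots> = fq_dim Q (S j) + 1"
    using gamma_nonzero by (simp add: fq_dim_mult_right[OF subsp_K] fq_dim_K)
  finally show ?case using Suc.IH by simp
qed

text \<open>If \<open>\<gamma> ^ j \<in> S j\<close> then \<open>S j\<close> is closed under multiplication by the generator \<open>\<gamma>\<close>, hence is all
  of \<open>W\<close>.\<close>

lemma gamma_power_notin_S:
  assumes "j < L" shows "\<gamma> ^ j \<notin> S j"
proof
  assume g: "\<gamma> ^ j \<in> S j"
  have "j > 0"
  proof (rule ccontr)
    assume "\<not> j > 0"
    then show False using g by (simp add: S_0)
  qed
  have closed: "u * \<gamma> \<in> S j" if u: "u \<in> S j" for u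
  proof -
    obtain v a where "v \<in> S j" "a \<in> K" "u * \<gamma> = v + a * \<gamma> ^ j"
      using S_mult_gamma[OF u] by (rule S_SucE)
    then show ?thesis using g by (auto intro!: subsp_add subsp_scale subsp_S)
  qed
  have "\<gamma> ^ r \<in> S j" for r
  proof (induction r)
    case 0 then show ?case using one_in_S[OF \<open>j > 0\<close>] by simp
  next
    case (Suc r) then show ?case using closed[of "\<gamma> ^ r"] by (simp add: mult.commute)
  qed
  then have "W - {0} \<subseteq> S j" unfolding W_gen by blast
  then have "W \<subseteq> S j" using subsp_0[OF subsp_S] by blast
  \<comment> \<open>A space generated by j < L elements is too small to contain \<open>W\<close>,
    which has dimension L.\<close>
  then have "L \<le> fq_dim Q (S j)"
    using fq_dim_mono[OF subsp_W subsp_S] fq_dim_W by metis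
  then show False using fq_dim_S_le[of j] assms by linarith
qed

lemma scaled_gamma_power_notin_S:
  assumes "j < L" "a \<in> K" "a \<noteq> 0" shows "a * \<gamma> ^ j \<notin> S j"
proof
  assume "a * \<gamma> ^ j \<in> S j"
  then have "inverse a * (a * \<gamma> ^ j) \<in> S j"
    using subsp_scale[OF subsp_S K_inverse[OF assms(2)]] by blast
  then show False
    using assms gamma_power_notin_S[of j] by (simp add: mult.assoc[symmetric])
qed

text \<open>As long as j < L, the line spanned by \<gamma>^j meets \<open>S j\<close> only in 0, so
  each step of the recursion raises the dimension by exactly one.\<close>

lemma fq_dim_S: "j \<le> L \<Longrightarrow> fq_dim Q (S j) = j"
proof (induction j)
  case 0 then show ?case by (simp add: S_0 fq_dim_zero)
next
  case (Suc j)
  have "S j \<inter> ((\<lambda>x. x * \<gamma> ^ j) ` K) = {0}"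
    using scaled_gamma_power_notin_S[of j] Suc.prems subsp_0[OF subsp_S] zero_in_K
    by force
  then show ?case
    using fq_dim_set_plus[OF subsp_S[of j] subsp_mult_right[OF subsp_K, of "\<gamma> ^ j"]] Suc
      gamma_nonzero
    by (simp add: S_Suc fq_dim_zero fq_dim_mult_right[OF subsp_K] fq_dim_K)
qed

lemma S_stable:
  assumes b: "b \<in> K" "b \<noteq> 0" shows "(\<lambda>x. x * b) ` S j = S j"
proof (rule card_subset_eq)
  show "(\<lambda>x. x * b) ` S j \<subseteq> S j"
    using subsp_scale[OF subsp_S b(1)] by (auto simp: mult.commute)
  have "inj_on (\<lambda>x. x * b) (S j)" using b by (auto intro: inj_onI)
  then show "card ((\<lambda>x. x * b) ` S j) = card (S j)" by (rule card_image)
qed simp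

text \<open>The leading term of \<open>b \<in> S j\<close> can be shifted to \<open>\<gamma> ^ j\<close> by a power of \<open>\<gamma>\<close> lying in \<open>S j\<close>.\<close>

lemma S_unstable:
  assumes b: "b \<notin> K" and j: "0 < j" "j < L"
  shows "(\<lambda>x. x * b) ` S j \<noteq> S j"
proof
  assume eq: "(\<lambda>x. x * b) ` S j = S j"
  have "1 * b \<in> (\<lambda>x. x * b) ` S j" by (rule imageI[OF one_in_S[OF j(1)]])
  then have bj: "b \<in> S j" unfolding eq by simp
  \<comment> \<open>With s = r + 1, the number r is the degree of b as a polynomial in \<gamma>. The
    hypothesis that b is not in K rules out r = 0.\<close>
  define s where "s = (LEAST s. b \<in> S s)"
  have bs: "b \<in> S s" and sj: "s \<le> j"
    unfolding s_def using bj by (auto intro: LeastI Least_le)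
  have "s \<noteq> 0"
  proof
    assume "s = 0"
    then show False using bs b zero_in_K by (simp add: S_0)
  qed
  then obtain r where r: "s = Suc r" using not0_implies_Suc by blast
  have "b \<notin> S r" using not_less_Least[of r "\<lambda>s. b \<in> S s"] r unfolding s_def by simp
  have "r \<noteq> 0"
  proof
    assume "r = 0"
    then show False using bs b S_1 r by simp
  qed
  obtain u a where u: "u \<in> S r" "a \<in> K" "b = u + a * \<gamma> ^ r"
    using bs unfolding r by (rule S_SucE)
  have "a \<noteq> 0" using u \<open>b \<notin> S r\<close> by auto
  have rj: "r + (j - r) = j" using sj r by simp
  \<comment> \<open>Since r > 0, the exponent j - r is below j, so \<gamma>^(j - r) lies in
    \<open>S j\<close> and stability applies to it. The product has leading term a * \<gamma>^j, and
    its remaining terms lie in \<open>S j\<close>.\<close>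
  have "\<gamma> ^ (j - r) * b \<in> (\<lambda>x. x * b) ` S j"
    using \<open>r \<noteq> 0\<close> j by (intro imageI gamma_power_in_S) simp
  then have "\<gamma> ^ (j - r) * b \<in> S j" unfolding eq .
  moreover have "u * \<gamma> ^ (j - r) \<in> S j"
    using S_mult_gamma_power[OF u(1), of "j - r"] unfolding rj .
  ultimately have "\<gamma> ^ (j - r) * b - u * \<gamma> ^ (j - r) \<in> S j"
    by (rule subsp_diff[OF subsp_S])
  also have "\<gamma> ^ (j - r) * b - u * \<gamma> ^ (j - r) = a * (\<gamma> ^ r * \<gamma> ^ (j - r))"
    unfolding u(3) by (simp add: algebra_simps)
  also have "\<gamma> ^ r * \<gamma> ^ (j - r) = \<gamma> ^ j"
    by (simp only: power_add[symmetric] rj)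
  finally show False
    using scaled_gamma_power_notin_S[OF j(2) u(2) \<open>a \<noteq> 0\<close>] by simp
qed

lemma dist_S_inside_K:
  "b \<in> K \<Longrightarrow> b \<noteq> 0 \<Longrightarrow> subspace_dist Q (S j) ((\<lambda>x. x * b) ` S j) = 0"
  by (simp add: S_stable subspace_dist_self subsp_S)

text \<open>If u and u * b were nonzero elements of \<open>S j\<close>, which lies in the field
  \<open>W\<close>, their quotient b would be in \<open>W\<close>. The intersection is therefore
  zero.\<close>

lemma dist_S_outside_W:
  assumes b: "b \<notin> W" and j: "j \<le> L"
  shows "subspace_dist Q (S j) ((\<lambda>x. x * b) ` S j) = 2 * j"
proof -
  have b0: "b \<noteq> 0" using b W.zero_in_K by auto
  have "u = 0" if "u \<in> S j" "u * b \<in> S j" for u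
  proof (rule ccontr)
    assume "u \<noteq> 0"
    have "inverse u * (u * b) \<in> W"
      using that S_subset_W by (blast intro: W.K_mult[OF W.K_inverse])
    then show False using \<open>u \<noteq> 0\<close> b by (simp add: mult.assoc[symmetric])
  qed
  then have "S j \<inter> (\<lambda>x. x * b) ` S j = {0}"
    using subsp_0[OF subsp_S] by force
  then show ?thesis
    using fq_dim_set_plus[OF subsp_S[of j] subsp_mult_right[OF subsp_S[of j], of b]] j b0
    unfolding subspace_dist_def
    by (simp add: fq_dim_zero fq_dim_S fq_dim_mult_right[OF subsp_S])
qed

text \<open>Both spaces have dimension j, so the distance is 2j minus twice the dimension of the
  intersection, and also twice the dimension of the sum minus 2j. The intersection is proper, which
  gives 2; the sum stays inside \<open>W\<close>, which gives 2 (L - j).\<close>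

lemma dist_S_between:
  assumes b: "b \<in> W" "b \<notin> K" and j: "0 < j" "j < L"
  shows "2 \<le> subspace_dist Q (S j) ((\<lambda>x. x * b) ` S j)"
    and "subspace_dist Q (S j) ((\<lambda>x. x * b) ` S j) \<le> 2 * min j (L - j)"
proof -
  let ?V = "(\<lambda>x. x * b) ` S j"
  have b0: "b \<noteq> 0" using b zero_in_K by auto
  have V: "subsp ?V" by (rule subsp_mult_right[OF subsp_S])
  have dim: "fq_dim Q (S j) = j" "fq_dim Q ?V = j"
    using j b0 by (simp_all add: fq_dim_S fq_dim_mult_right[OF subsp_S])
  have sum: "fq_dim Q (set_plus (S j) ?V) + fq_dim Q (S j \<inter> ?V) = 2 * j"
    using fq_dim_set_plus[OF subsp_S V, of j] dim by simp
  have "S j \<inter> ?V \<noteq> S j"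
  proof
    assume "S j \<inter> ?V = S j"
    then have "S j \<subseteq> ?V" by blast
    moreover have "card (S j) = card ?V"
      using card_subsp[OF subsp_S] card_subsp[OF V] dim by simp
    ultimately have "S j = ?V" by (intro card_subset_eq) simp_all
    then show False using S_unstable[OF b(2) j] by simp
  qed
  then have "S j \<inter> ?V \<subset> S j" by blast
  then have lt: "fq_dim Q (S j \<inter> ?V) < j"
    using fq_dim_strict_mono[OF subsp_Int[OF subsp_S V] subsp_S] dim by metis
  have "set_plus (S j) ?V \<subseteq> W"
    using S_subset_W b(1) by (auto elim!: set_plusE intro!: W.K_add W.K_mult)
  then have "fq_dim Q (set_plus (S j) ?V) \<le> L"
    using fq_dim_mono[OF subsp_set_plus[OF subsp_S V] subsp_W] fq_dim_W by metis
  then show "2 \<le> subspace_dist Q (S j) ?V" "subspace_dist Q (S j) ?V \<le> 2 * min j (L - j)"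
    using sum lt j unfolding subspace_dist_def by linarith+
qed

end

text \<open>Passing from L to L + 2 adds 2 to each of the L - 1 old terms and creates two end terms
  equal to 2. The increase 2L + 2 is also that of floor(L^2 / 2), hence an induction in steps of
  two.\<close>

lemma sum_min_reflect: "(\<Sum>j=1..<L. 2 * min j (L - j)) = L\<^sup>2 div (2::nat)"
proof (induction L rule: induct_nat_012)
  case (ge2 L)
  show ?case
  \<comment> \<open>For L = 0 the new range has a single index, so the two end terms
    coincide.\<close>
  proof (cases "L = 0")
    case False
    have "(\<Sum>j=1..<Suc (Suc L). 2 * min j (Suc (Suc L) - j))
        = (\<Sum>j=0..<Suc L. 2 * min (Suc j) (Suc L - j))"
      using sum.shift_bounds_Suc_ivl[of "\<lambda>j. 2 * min j (Suc (Suc L) - j)" 0 "Suc L"] by simp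
    also have "\<dots> = (\<Sum>j=0..<L. 2 * min (Suc j) (Suc L - j)) + 2"
      by simp
    also have "(\<Sum>j=0..<L. 2 * min (Suc j) (Suc L - j)) = 2 + (\<Sum>j=1..<L. 2 * min (Suc j) (Suc L - j))"
      using False by (subst sum.atLeast_Suc_lessThan) auto
    also have "(\<Sum>j=1..<L. 2 * min (Suc j) (Suc L - j)) = (\<Sum>j=1..<L. 2 * min j (L - j) + 2)"
      by (rule sum.cong) (auto simp: min_def)
    also have "\<dots> = L\<^sup>2 div 2 + 2 * (L - 1)"
      unfolding sum.distrib ge2.IH(1) by simp
    finally have "(\<Sum>j=1..<Suc (Suc L). 2 * min j (Suc (Suc L) - j)) = L\<^sup>2 div 2 + 2 * (L - 1) + 4"
      by simp
    moreover have "(Suc (Suc L))\<^sup>2 = L\<^sup>2 + 2 * (2 * L + 2)"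
      by (simp add: power2_eq_square)
    ultimately show ?thesis using False by simp
  qed (simp add: power2_eq_square)
qed simp_all

section \<open>Finite fields and cyclic orbits\<close>

text \<open>The characteristic divides the number of elements, a power of the prime p under q, so it
  equals p and the Frobenius map applies.\<close>

lemma power_primepow_add:
  fixes x y :: "'a::{field,finite}"
  assumes q: "primepow q" and card: "card (UNIV :: 'a set) = q ^ n"
  shows "(x + y) ^ (q ^ e) = x ^ (q ^ e) + y ^ (q ^ e)"
proof -
  obtain p r where p: "prime p" "q = p ^ r"
    using q unfolding primepow_def by blast
  have ch: "prime CHAR('a)"
    by (intro prime_CHAR_semidom finite_imp_CHAR_pos) simp
  have "CHAR('a) dvd p ^ (r * n)"
    using CHAR_dvd_CARD[where 'a = 'a] unfolding card p(2) by (simp add: power_mult)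
  then have "CHAR('a) = p"
    using ch p(1) prime_dvd_power primes_dvd_imp_eq by blast
  then show ?thesis
    using ch freshmans_dream'[of "q ^ e" "r * e" x y] p(2) by (simp add: power_mult)
qed

lemma
  fixes b :: "'a::{field,finite}"
  assumes "b \<noteq> 0"
  shows mult_order_pos: "0 < mult_order b"
    and power_mult_order: "b ^ mult_order b = 1"
proof -
  have "\<not> inj (\<lambda>r::nat. b ^ r)"
    using finite_imageD[of "\<lambda>r::nat. b ^ r" UNIV] by auto
  then obtain i j :: nat where "b ^ i = b ^ j" "i \<noteq> j"
    unfolding inj_def by blast
  then obtain i j :: nat where ij: "b ^ i = b ^ j" "i < j"
    by (metis nat_neq_iff)
  have "b ^ j = b ^ i * b ^ (j - i)"
    using ij(2) by (simp add: power_add[symmetric])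
  then have "0 < j - i \<and> b ^ (j - i) = 1"
    using ij assms by simp
  then have "0 < mult_order b \<and> b ^ mult_order b = 1"
    unfolding mult_order_def by (rule LeastI)
  then show "0 < mult_order b" "b ^ mult_order b = 1" by blast+
qed

lemma power_mod_mult_order:
  fixes b :: "'a::{field,finite}"
  assumes "b \<noteq> 0" shows "b ^ (j mod mult_order b) = b ^ j"
proof -
  have "b ^ j = b ^ (mult_order b * (j div mult_order b) + j mod mult_order b)"
    by simp
  also have "\<dots> = b ^ (j mod mult_order b)"
    unfolding power_add power_mult power_mult_order[OF assms] by simp
  finally show ?thesis ..
qed

lemma power_eq_1_iff_mult_order_dvd:
  fixes b :: "'a::{field,finite}"
  assumes "b \<noteq> 0" shows "b ^ j = 1 \<longleftrightarrow> mult_order b dvd j"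
proof
  assume "b ^ j = 1"
  then have "b ^ (j mod mult_order b) = 1"
    by (simp add: power_mod_mult_order assms)
  then have "\<not> 0 < j mod mult_order b"
    using not_less_Least[of "j mod mult_order b" "\<lambda>d. 0 < d \<and> b ^ d = 1"]
      mod_less_divisor[OF mult_order_pos[OF assms], of j]
    unfolding mult_order_def[symmetric] by auto
  then show "mult_order b dvd j" by (simp add: mod_eq_0_iff_dvd)
next
  assume "mult_order b dvd j"
  then show "b ^ j = 1" by (auto simp: power_mult power_mult_order assms)
qed

lemma powers_eq_image:
  fixes b :: "'a::{field,finite}"
  assumes "b \<noteq> 0" shows "range (\<lambda>r. b ^ r) = (\<lambda>r. b ^ r) ` {..<mult_order b}"
proof
  show "range (\<lambda>r. b ^ r) \<subseteq> (\<lambda>r. b ^ r) ` {..<mult_order b}"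
  proof clarify
    fix r
    show "b ^ r \<in> (\<lambda>r. b ^ r) ` {..<mult_order b}"
      using power_mod_mult_order[OF assms, of r] mult_order_pos[OF assms]
      by (intro image_eqI[of _ _ "r mod mult_order b"]) simp_all
  qed
qed blast

lemma card_powers:
  fixes b :: "'a::{field,finite}"
  assumes "b \<noteq> 0" shows "card (range (\<lambda>r. b ^ r)) = mult_order b"
proof -
  have False if "i < j" "j < mult_order b" "b ^ i = b ^ j" for i j
  proof -
    have "b ^ j = b ^ i * b ^ (j - i)"
      using that(1) by (simp add: power_add[symmetric])
    then have "mult_order b dvd j - i"
      using that(3) assms by (simp add: power_eq_1_iff_mult_order_dvd)
    then show False using that(1,2) by (simp add: nat_dvd_not_less)
  qed
  then have "inj_on (\<lambda>r. b ^ r) {..<mult_order b}"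
    by (intro inj_onI) (metis lessThan_iff nat_neq_iff)
  then show ?thesis
    unfolding powers_eq_image[OF assms] by (simp add: card_image)
qed

section \<open>The cyclic group of a multiplier and its orbit\<close>

lemma cyc_group_eq_powers: "cyc_group b = range (\<lambda>r. b ^ r)"
  unfolding cyc_group_def by auto

lemma cyc_group_nonzero: "x \<in> cyc_group b \<Longrightarrow> b \<noteq> 0 \<Longrightarrow> x \<noteq> 0"
  unfolding cyc_group_def by auto

lemma cyc_group_divide:
  assumes x: "x \<in> cyc_group b" and y: "y \<in> cyc_group b" and b: "b \<noteq> 0"
  shows "y / x \<in> cyc_group b"
proof -
  obtain i j where ij: "x = b ^ i" "y = b ^ j"
    using x y unfolding cyc_group_def by blast
  \<comment> \<open>\<open>cyc_group\<close> has only natural exponents, so the inverse of b^i is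
    written as b^r with i + r a multiple of the order.\<close>
  define r where "r = mult_order b * i - i"
  have "i + r = mult_order b * i"
    unfolding r_def using mult_order_pos[OF b] by simp
  then have "b ^ i * b ^ r = 1"
    by (simp add: power_add[symmetric] power_mult power_mult_order[OF b])
  then have "y / x = b ^ (j + r)"
    using b unfolding ij by (simp add: power_add field_simps)
  then show ?thesis unfolding cyc_group_def by blast
qed

lemma orbit_eq_image:
  assumes "b \<noteq> 0" shows "orbit b F = flag_mult F ` cyc_group b"
  unfolding cyc_group_eq_powers powers_eq_image[OF assms] orbit_def by auto

lemma flag_mult_mult: "flag_mult (flag_mult F b) c = flag_mult F (b * c)"
  unfolding flag_mult_def by (simp add: image_image mult.assoc)

lemma flag_mult_1: "flag_mult F 1 = F"
  unfolding flag_mult_def by (simp add: map_idI)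

lemma power_minus_1_dvd: "d dvd e \<Longrightarrow> q ^ d - 1 dvd q ^ e - (1::nat)"
proof -
  assume "d dvd e"
  then obtain c where c: "e = d * c" by blast
  have "[(q ^ d) ^ c = 1 ^ c] (mod (q ^ d - 1))" if "q ^ d \<ge> 1"
    using that by (intro cong_pow) (simp add: cong_altdef_nat)
  moreover have "q ^ e \<ge> 1" if "q ^ d \<ge> 1"
    using that unfolding c power_mult by (rule one_le_power)
  ultimately show ?thesis
    \<comment> \<open>If q^d = 0, both differences truncate to 0.\<close>
    by (cases "q ^ d \<ge> 1")
      (auto simp: c power_mult cong_altdef_nat power_0_left not_le)
qed

section \<open>Subfields in terms of a primitive element\<close>

locale primitive_field =
  fixes q n :: nat and \<alpha> :: "'a::{field,finite}"
  assumes q: "primepow q"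
    and card_UNIV: "card (UNIV::'a set) = q ^ n"
    and n: "1 < n"
    and prim: "\<And>x::'a. x \<noteq> 0 \<Longrightarrow> \<exists>j. x = \<alpha> ^ j"
begin

lemma q_gt_1: "1 < q"
  using q by (rule primepow_gt_Suc_0[unfolded One_nat_def[symmetric]])

lemma q_power_gt_1: "0 < e \<Longrightarrow> 1 < q ^ e"
  using q_gt_1 by (rule one_less_power)

text \<open>The powers of 0 are 0 and, because 0^0 = 1, also 1. They exhaust the nonzero elements
  only in a field of two elements, whereas q^n is at least 4.\<close>

lemma alpha_nonzero: "\<alpha> \<noteq> 0"
proof
  assume "\<alpha> = 0"
  then have "x \<in> {0, 1}" for x :: 'a
    using prim[of x] by (cases "x = 0") (auto simp: power_0_left split: if_splits)
  then have "card (UNIV :: 'a set) \<le> card {0, 1::'a}"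
    by (intro card_mono) auto
  moreover have "2 ^ 2 \<le> q ^ n"
    using q_gt_1 n power_mono[of 2 q 2] power_increasing[of 2 n q] by linarith
  ultimately show False using card_UNIV by simp
qed

lemma UNIV_minus_0: "UNIV - {0} = range (\<lambda>r. \<alpha> ^ r)"
proof
  show "UNIV - {0} \<subseteq> range (\<lambda>r. \<alpha> ^ r)" using prim by blast
  show "range (\<lambda>r. \<alpha> ^ r) \<subseteq> UNIV - {0}" using alpha_nonzero by auto
qed

lemma mult_order_alpha: "mult_order \<alpha> = q ^ n - 1"
  using card_powers[OF alpha_nonzero] unfolding UNIV_minus_0[symmetric]
  by (simp add: card_Diff_singleton card_UNIV)

text \<open>Write c for the quotient and d = q^e - 1, so that \<alpha> has order c * d. Then
  \<alpha>^j lies in the subfield iff c * d divides j * d, that is, iff c divides j. Hence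
  \<alpha>^c generates the nonzero part and has order d.\<close>

lemma
  assumes e: "0 < e" "e dvd n"
  shows subfld_minus_0: "subfld (q ^ e) - {0::'a} = range (\<lambda>r. (\<alpha> ^ ((q ^ n - 1) div (q ^ e - 1))) ^ r)"
    and card_subfld: "card (subfld (q ^ e) :: 'a set) = q ^ e"
proof -
  define d where "d = q ^ e - 1"
  define c where "c = (q ^ n - 1) div (q ^ e - 1)"
  have d: "0 < d" "q ^ e = Suc d"
    using q_power_gt_1[OF e(1)] unfolding d_def by simp_all
  have cd: "q ^ n - 1 = c * d"
    using power_minus_1_dvd[OF e(2), of q] unfolding c_def d_def by simp
  moreover have "1 < q ^ n" using q_power_gt_1 n by simp
  ultimately have c: "0 < c" by (cases "c = 0") simp_all
  have pow: "\<alpha> ^ j \<in> subfld (q ^ e) \<longleftrightarrow> c dvd j" for j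
  proof -
    have "\<alpha> ^ j \<in> subfld (q ^ e) \<longleftrightarrow> (\<alpha> ^ j) ^ d = 1"
      using alpha_nonzero unfolding subfld_def d(2) by simp
    also have "\<dots> \<longleftrightarrow> c * d dvd j * d"
      unfolding power_mult[symmetric] power_eq_1_iff_mult_order_dvd[OF alpha_nonzero] mult_order_alpha cd ..
    also have "\<dots> \<longleftrightarrow> c dvd j" using d(1) by simp
    finally show ?thesis .
  qed
  show gen: "subfld (q ^ e) - {0::'a} = range (\<lambda>r. (\<alpha> ^ ((q ^ n - 1) div (q ^ e - 1))) ^ r)"
    unfolding c_def[symmetric]
  proof
    show "subfld (q ^ e) - {0} \<subseteq> range (\<lambda>r. (\<alpha> ^ c) ^ r)"
    proof
      fix x :: 'a assume x: "x \<in> subfld (q ^ e) - {0}"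
      then obtain j where j: "x = \<alpha> ^ j" using prim by blast
      then have "c dvd j" using x pow by simp
      then show "x \<in> range (\<lambda>r. (\<alpha> ^ c) ^ r)"
        unfolding j by (auto simp: power_mult)
    qed
    show "range (\<lambda>r. (\<alpha> ^ c) ^ r) \<subseteq> subfld (q ^ e) - {0}"
      using alpha_nonzero by (auto simp: power_mult[symmetric] pow)
  qed
  have ac: "\<alpha> ^ c \<noteq> 0" using alpha_nonzero by simp
  have "mult_order (\<alpha> ^ c) dvd j \<longleftrightarrow> d dvd j" for j
  proof -
    have "mult_order (\<alpha> ^ c) dvd j \<longleftrightarrow> (\<alpha> ^ c) ^ j = 1"
      using power_eq_1_iff_mult_order_dvd[OF ac] by simp
    also have "\<dots> \<longleftrightarrow> c * d dvd c * j"
      unfolding power_mult[symmetric] power_eq_1_iff_mult_order_dvd[OF alpha_nonzero] mult_order_alpha cd ..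
    also have "\<dots> \<longleftrightarrow> d dvd j" using c by simp
    finally show ?thesis .
  qed
  then have "mult_order (\<alpha> ^ c) = d" by (metis dvd_antisym dvd_refl)
  then have "card (subfld (q ^ e) - {0} :: 'a set) = d"
    unfolding gen c_def[symmetric] using card_powers[OF ac] by simp
  moreover have "(0::'a) \<in> subfld (q ^ e)" unfolding subfld_def d(2) by simp
  then have "card (subfld (q ^ e) :: 'a set) = Suc (card (subfld (q ^ e) - {0::'a}))"
    by (intro card.remove) simp_all
  ultimately show "card (subfld (q ^ e) :: 'a set) = q ^ e"
    by (simp only: d(2))
qed

lemma frobenius_subfield_subfld:
  assumes "0 < e" "e dvd n"
  shows "frobenius_subfield (q ^ e) (subfld (q ^ e) :: 'a set)"
proof (rule frobenius_subfield.intro)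
  show "(x + y) ^ (q ^ e) = x ^ (q ^ e) + y ^ (q ^ e)" for x y :: 'a
    by (rule power_primepow_add[OF q card_UNIV])
  show "card (subfld (q ^ e) :: 'a set) = q ^ e"
    by (rule card_subfld[OF assms])
qed (rule refl)

end

section \<open>The weaved flag\<close>

locale weaved_setup = primitive_field q n \<alpha>
  for q n :: nat and \<alpha> :: "'a::{field,finite}" +
  fixes k :: nat and m :: "nat \<Rightarrow> nat"
  assumes k: "1 \<le> k"
    and m1: "0 < m 1"
    and mn: "m (k + 1) = n"
    and m_less: "\<And>i. 1 \<le> i \<Longrightarrow> i \<le> k \<Longrightarrow> m i < m (i + 1)"
    and m_dvd_Suc: "\<And>i. 1 \<le> i \<Longrightarrow> i \<le> k \<Longrightarrow> m i dvd m (i + 1)"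
begin

abbreviation Fld :: "nat \<Rightarrow> 'a set" where
  "Fld i \<equiv> subfld (q ^ m i)"

abbreviation Flag :: "'a set list" where
  "Flag \<equiv> weaved_flag q n m k \<alpha>"

lemma m_pos: "1 \<le> i \<Longrightarrow> i \<le> k + 1 \<Longrightarrow> 0 < m i"
proof (induction i rule: dec_induct)
  case base then show ?case using m1 by simp
next
  case (step i) then show ?case using m_less[of i] by simp
qed

lemma m_dvd: "i \<le> j \<Longrightarrow> 1 \<le> i \<Longrightarrow> j \<le> k + 1 \<Longrightarrow> m i dvd m j"
proof (induction j rule: dec_induct)
  case (step j) then show ?case using m_dvd_Suc[of j] by (auto intro: dvd_trans)
qed simp

lemma m_Suc_eq: "1 \<le> i \<Longrightarrow> i \<le> k \<Longrightarrow> m (i + 1) = m i * Lq m (i + 1)"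
  using m_dvd_Suc[of i] by (simp add: Lq_def)

lemma Lq_ge_2: "1 \<le> i \<Longrightarrow> i \<le> k \<Longrightarrow> 2 \<le> Lq m (i + 1)"
proof (rule ccontr)
  assume i: "1 \<le> i" "i \<le> k" and "\<not> 2 \<le> Lq m (i + 1)"
  then have "Lq m (i + 1) \<le> 1" by simp
  then have "m i * Lq m (i + 1) \<le> m i * 1" by (rule mult_le_mono2)
  then show False using m_Suc_eq[OF i] m_less[OF i] by simp
qed

lemma Fld_subfield:
  assumes "1 \<le> i" "i \<le> k + 1" shows "frobenius_subfield (q ^ m i) (Fld i)"
  using m_dvd[of i "k + 1"] m_pos[of i] assms mn by (intro frobenius_subfield_subfld) simp_all

lemma base_subfield: "frobenius_subfield q (subfld q :: 'a set)"
  using frobenius_subfield_subfld[of 1] by simp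

lemma base_subset_Fld: "subfld q \<subseteq> Fld i"
proof
  fix x :: 'a assume "x \<in> subfld q"
  then have "x ^ (q ^ r) = x" for r
    by (induction r) (auto simp: subfld_def power_mult)
  then show "x \<in> Fld i" by (simp add: subfld_def)
qed

text \<open>The index is shifted: level i has scalars F_{q^{m_i}}, but its generator \<alpha>_{i+1}
  and its degree L_{i+1} belong to the next field.\<close>

lemma weave_level_Fld:
  assumes i: "1 \<le> i" "i \<le> k"
  shows "weave_level (q ^ m i) (Fld i) (Lq m (i + 1)) (Fld (i + 1)) (alph q n m \<alpha> (i + 1))"
proof -
  have "(q ^ m i) ^ Lq m (i + 1) = q ^ m (i + 1)"
    unfolding m_Suc_eq[OF i] by (simp add: power_mult)
  moreover have "Fld (i + 1) - {0} = range (\<lambda>r. alph q n m \<alpha> (i + 1) ^ r)"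
    unfolding alph_def using i m_pos[of "i + 1"] m_dvd[of "i + 1" "k + 1"] mn
    by (intro subfld_minus_0) simp_all
  ultimately show ?thesis
    using Fld_subfield[of i] Fld_subfield[of "i + 1"] i
    unfolding weave_level_def weave_level_axioms_def by simp
qed

lemma Fld_mono: "i \<le> j \<Longrightarrow> 1 \<le> i \<Longrightarrow> j \<le> k + 1 \<Longrightarrow> Fld i \<subseteq> Fld j"
proof (induction j rule: dec_induct)
  case (step j)
  interpret weave_level "q ^ m j" "Fld j" "Lq m (j + 1)" "Fld (j + 1)" "alph q n m \<alpha> (j + 1)"
    using step by (intro weave_level_Fld) simp_all
  show ?case using step K_subset_W by simp
qed simp

lemma Fld_top: "Fld (k + 1) = UNIV"
proof -
  have "card (Fld (k + 1)) = card (UNIV :: 'a set)"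
    using card_subfld[of n] n mn card_UNIV by simp
  then show ?thesis by (simp add: card_eq_UNIV_imp_eq_UNIV)
qed

definition level_dist :: "nat \<Rightarrow> nat \<Rightarrow> 'a \<Rightarrow> nat" where
  "level_dist i j b = subspace_dist q (Fij q n m \<alpha> i j) ((\<lambda>x. x * b) ` Fij q n m \<alpha> i j)"

context
  fixes i j :: nat
  assumes i: "1 \<le> i" "i \<le> k"
begin

interpretation level: weave_level "q ^ m i" "Fld i" "Lq m (i + 1)" "Fld (i + 1)" "alph q n m \<alpha> (i + 1)"
  by (rule weave_level_Fld[OF i])

interpretation base: frobenius_subfield q "subfld q :: 'a set"
  by (rule base_subfield)

lemma Fij_eq_S: "Fij q n m \<alpha> i j = level.S j"
  unfolding Fij_def level.S_def by simp

lemma base_subsp: "level.subsp U \<Longrightarrow> base.subsp U"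
  unfolding level.subsp_def base.subsp_def using base_subset_Fld by blast

lemma base_subsp_Fij: "base.subsp (Fij q n m \<alpha> i j)"
  unfolding Fij_eq_S by (intro base_subsp level.subsp_S)

lemma level_dist_eq:
  "level_dist i j b = m i * subspace_dist (q ^ m i) (level.S j) ((\<lambda>x. x * b) ` level.S j)"
  unfolding level_dist_def Fij_eq_S
  by (intro subspace_dist_scale[of _ "subfld q" _ "Fld i"] base_subfield Fld_subfield base_subsp
      level.subsp_S level.subsp_mult_right) (use i in simp_all)

lemma Fij_stable: "b \<in> Fld i \<Longrightarrow> b \<noteq> 0 \<Longrightarrow> (\<lambda>x. x * b) ` Fij q n m \<alpha> i j = Fij q n m \<alpha> i j"
  unfolding Fij_eq_S by (rule level.S_stable)

lemma level_dist_inside: "b \<in> Fld i \<Longrightarrow> b \<noteq> 0 \<Longrightarrow> level_dist i j b = 0"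
  unfolding level_dist_eq by (subst level.dist_S_inside_K) simp_all

lemma level_dist_outside:
  "b \<notin> Fld (i + 1) \<Longrightarrow> j \<le> Lq m (i + 1) \<Longrightarrow> level_dist i j b = m i * (2 * j)"
  unfolding level_dist_eq by (subst level.dist_S_outside_W) simp_all

lemma level_dist_between:
  assumes "b \<in> Fld (i + 1)" "b \<notin> Fld i" "0 < j" "j < Lq m (i + 1)"
  shows "m i * 2 \<le> level_dist i j b" "level_dist i j b \<le> m i * (2 * min j (Lq m (i + 1) - j))"
  unfolding level_dist_eq using level.dist_S_between[OF assms] by (simp_all only: mult_le_mono2)

end

definition level_sum :: "nat \<Rightarrow> 'a \<Rightarrow> nat" where
  "level_sum i b = (\<Sum>j=1..<Lq m (i + 1). level_dist i j b)"

lemma level_sum_inside: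
  "1 \<le> i \<Longrightarrow> i \<le> k \<Longrightarrow> b \<in> Fld i \<Longrightarrow> b \<noteq> 0 \<Longrightarrow> level_sum i b = 0"
  unfolding level_sum_def by (simp add: level_dist_inside)

text \<open>This is one summand of M, namely m_i times the sum of 2j, rewritten by m_i L_{i+1} =
  m_{i+1}.\<close>

lemma level_sum_outside:
  assumes i: "1 \<le> i" "i \<le> k" and b: "b \<notin> Fld (i + 1)"
  shows "level_sum i b = m (i + 1) * (Lq m (i + 1) - 1)"
proof -
  have gauss: "(\<Sum>j=1..<L. 2 * j) = L * (L - 1)" for L :: nat
    by (induction L) (auto simp: algebra_simps)
  have "level_sum i b = (\<Sum>j=1..<Lq m (i + 1). m i * (2 * j))"
    unfolding level_sum_def by (intro sum.cong level_dist_outside i b) auto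
  also have "\<dots> = m i * (Lq m (i + 1) * (Lq m (i + 1) - 1))"
    unfolding sum_distrib_left[of "m i", symmetric] gauss ..
  finally show ?thesis using m_Suc_eq[OF i] by simp
qed

lemma level_sum_between:
  assumes i: "1 \<le> i" "i \<le> k" and b: "b \<in> Fld (i + 1)" "b \<notin> Fld i"
  shows "2 * m i * (Lq m (i + 1) - 1) \<le> level_sum i b"
    and "level_sum i b \<le> m i * ((Lq m (i + 1))\<^sup>2 div 2)"
proof -
  have "(\<Sum>j=1..<Lq m (i + 1). m i * 2) \<le> level_sum i b"
    unfolding level_sum_def by (intro sum_mono level_dist_between i b) auto
  then show "2 * m i * (Lq m (i + 1) - 1) \<le> level_sum i b"
    by (simp add: algebra_simps)
  have "level_sum i b \<le> (\<Sum>j=1..<Lq m (i + 1). m i * (2 * min j (Lq m (i + 1) - j)))"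
    unfolding level_sum_def by (intro sum_mono level_dist_between i b) auto
  also have "\<dots> = m i * ((Lq m (i + 1))\<^sup>2 div 2)"
    unfolding sum_distrib_left[of "m i", symmetric] sum_min_reflect ..
  finally show "level_sum i b \<le> m i * ((Lq m (i + 1))\<^sup>2 div 2)" .
qed

lemma set_Flag: "set Flag = (\<Union>i\<in>{1..k}. Fij q n m \<alpha> i ` {1..<Lq m (Suc i)})"
  unfolding weaved_flag_def by (simp add: atLeastLessThanSuc_atLeastAtMost del: upt_Suc)

lemma base_subsp_Flag:
  "U \<in> set Flag \<Longrightarrow> frobenius_subfield.subsp (subfld q) U"
  unfolding set_Flag using base_subsp_Fij by auto

lemma flag_dist_map:
  "flag_dist q F (flag_mult F b) = (\<Sum>U\<leftarrow>F. subspace_dist q U ((\<lambda>x. x * b) ` U))"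
  unfolding flag_dist_def flag_mult_def by (simp add: sum_list_sum_nth atLeast0LessThan)

lemma flag_dist_Flag: "flag_dist q Flag (flag_mult Flag b) = (\<Sum>i=1..k. level_sum i b)"
proof -
  have concat: "sum_list (map f (concat xss)) = (\<Sum>xs\<leftarrow>xss. sum_list (map f xs))"
    for f :: "'a set \<Rightarrow> nat" and xss by (induction xss) simp_all
  have upt: "sum_list (map f [x..<y]) = sum f {x..<y}" for f :: "nat \<Rightarrow> nat" and x y
    by (simp add: interv_sum_list_conv_sum_set_nat)
  show ?thesis
    unfolding flag_dist_map weaved_flag_def concat
    by (simp add: o_def upt level_sum_def level_dist_def atLeastLessThanSuc_atLeastAtMost
        del: upt_Suc)
qed

text \<open>An element of the bottom field is a scalar at every level. Consequently the quotient of
  the multipliers of two distinct codewords lies outside \<open>Fld 1\<close>.\<close>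

lemma flag_mult_stable:
  assumes "b \<in> Fld 1" "b \<noteq> 0" shows "flag_mult Flag b = Flag"
  unfolding flag_mult_def
proof (rule map_idI)
  fix U assume "U \<in> set Flag"
  then obtain i j where ij: "1 \<le> i" "i \<le> k" "U = Fij q n m \<alpha> i j"
    unfolding set_Flag by auto
  have "b \<in> Fld i" using Fld_mono[of 1 i] ij(1,2) assms(1) by auto
  then show "(\<lambda>x. x * b) ` U = U"
    unfolding ij(3) by (rule Fij_stable[OF ij(1,2) _ assms(2)])
qed

text \<open>Multiplication by x is an F_q-linear bijection and preserves distances, so one of the
  two codewords may be taken to be the flag itself.\<close>

lemma flag_dist_translate:
  assumes x: "x \<noteq> 0"
  shows "flag_dist q (flag_mult Flag x) (flag_mult Flag y) = flag_dist q Flag (flag_mult Flag (y / x))"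
proof -
  interpret frobenius_subfield q "subfld q :: 'a set" by (rule base_subfield)
  define c where "c = y / x"
  have y: "y = c * x" unfolding c_def using x by simp
  have "subspace_dist q (flag_mult Flag x ! r) (flag_mult Flag y ! r)
      = subspace_dist q (Flag ! r) (flag_mult Flag c ! r)" if r: "r < length Flag" for r
  proof -
    have "subsp (Flag ! r)" by (rule base_subsp_Flag[OF nth_mem[OF r]])
    moreover have "flag_mult Flag y ! r = (\<lambda>u. u * x) ` ((\<lambda>u. u * c) ` (Flag ! r))"
      using r unfolding flag_mult_def y by (simp add: image_image mult.assoc)
    ultimately show ?thesis
      using r subspace_dist_mult_right[OF _ subsp_mult_right x] by (simp add: flag_mult_def)
  qed
  then show ?thesis
    unfolding flag_dist_def c_def[symmetric] by (simp add: flag_mult_def)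
qed

section \<open>Distance bounds by the level of the multiplier\<close>

lemma Mq_Suc: "1 \<le> s \<Longrightarrow> Mq m (s + 1) = Mq m s + m (s + 1) * (Lq m (s + 1) - 1)"
  by (cases s) (simp_all add: Mq_def)

lemma flag_dist_bounds:
  assumes s: "1 \<le> s" "s \<le> k" and b: "b \<in> Fld (s + 1)" "b \<notin> Fld s"
  shows "2 * m s * (Lq m (s + 1) - 1) + Mq m s \<le> flag_dist q Flag (flag_mult Flag b)"
    and "flag_dist q Flag (flag_mult Flag b) \<le> m s * ((Lq m (s + 1))\<^sup>2 div 2) + Mq m s"
proof -
  interpret F: frobenius_subfield "q ^ m s" "Fld s" using s by (intro Fld_subfield) simp_all
  have b0: "b \<noteq> 0" using b(2) F.zero_in_K by auto
  have "{1..k} = {1..s-1} \<union> ({s} \<union> {s+1..k})" using s by auto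
  then have "(\<Sum>i=1..k. level_sum i b)
      = (\<Sum>i=1..s-1. level_sum i b) + (\<Sum>i\<in>{s} \<union> {s+1..k}. level_sum i b)"
    by (simp only:, intro sum.union_disjoint) (use s in auto)
  also have "(\<Sum>i\<in>{s} \<union> {s+1..k}. level_sum i b) = level_sum s b + (\<Sum>i=s+1..k. level_sum i b)"
    by simp
  also have "(\<Sum>i=s+1..k. level_sum i b) = 0"
  proof (rule sum.neutral, rule ballI)
    fix i assume "i \<in> {s+1..k}"
    then show "level_sum i b = 0"
      using Fld_mono[of "s + 1" i] b(1) b0 by (intro level_sum_inside) auto
  qed
  also have "(\<Sum>i=1..s-1. level_sum i b) = Mq m s"
    unfolding Mq_def
  proof (rule sum.cong[OF refl])
    fix i assume "i \<in> {1..s-1}"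
    \<comment> \<open>Level i is governed by membership in \<open>Fld (i + 1)\<close>, and i + 1 <=
      s places this field inside \<open>Fld s\<close>, which does not contain b.\<close>
    then have "1 \<le> i" "i + 1 \<le> s" by auto
    then show "level_sum i b = m (i + 1) * (Lq m (i + 1) - 1)"
      using Fld_mono[of "i + 1" s] b(2) s by (intro level_sum_outside) auto
  qed
  finally have "flag_dist q Flag (flag_mult Flag b) = Mq m s + level_sum s b"
    unfolding flag_dist_Flag by simp
  then show "2 * m s * (Lq m (s + 1) - 1) + Mq m s \<le> flag_dist q Flag (flag_mult Flag b)"
    and "flag_dist q Flag (flag_mult Flag b) \<le> m s * ((Lq m (s + 1))\<^sup>2 div 2) + Mq m s"
    using level_sum_between[OF s b] by simp_all
qed

text \<open>Since L_{t+1} is at least 2, twice m_t is at most m_{t+1}. The bound at t is then at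
  most m_{t+1} (L_{t+1} - 1) + M_t = M_{t+1}, already a part of the bound at t + 1.\<close>

lemma lower_bound_mono:
  assumes "s \<le> t" "1 \<le> s" "t \<le> k"
  shows "2 * m s * (Lq m (s + 1) - 1) + Mq m s \<le> 2 * m t * (Lq m (t + 1) - 1) + Mq m t"
  using assms
proof (induction t rule: dec_induct)
  case (step t)
  have "2 * m t \<le> m (t + 1)"
    using m_Suc_eq[of t] Lq_ge_2[of t] step by (metis Suc_leD Suc_eq_plus1 le_trans mult.commute mult_le_mono2)
  then have "2 * m t * (Lq m (t + 1) - 1) + Mq m t \<le> Mq m (t + 1)"
    using step by (subst Mq_Suc) (auto intro: mult_le_mono1)
  then show ?case using step by simp
qed simp

text \<open>The least t with b in \<open>Fld (t + 1)\<close> works; it exists because the top field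
  is everything, and the hypothesis covers t = 1.\<close>

lemma exists_level:
  assumes "b \<notin> Fld 1"
  obtains t where "1 \<le> t" "t \<le> k" "b \<in> Fld (t + 1)" "b \<notin> Fld t"
proof -
  define t where "t = (LEAST t. 1 \<le> t \<and> b \<in> Fld (t + 1))"
  have ex: "1 \<le> k \<and> b \<in> Fld (k + 1)" using k Fld_top by simp
  then have t: "1 \<le> t \<and> b \<in> Fld (t + 1)" unfolding t_def by (rule LeastI)
  have "t \<le> k" unfolding t_def using ex by (rule Least_le)
  moreover have "b \<notin> Fld t"
  proof (cases "t = 1")
    case False
    then have t1: "1 \<le> t - 1" "t - 1 + 1 = t" "t - 1 < t" using t by auto
    then show ?thesis
      using not_less_Least[of "t - 1" "\<lambda>t. 1 \<le> t \<and> b \<in> Fld (t + 1)"]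
      unfolding t_def[symmetric] t1(2) by blast
  qed (use assms in simp)
  ultimately show thesis using that t by blast
qed

text \<open>The hypothesis \<open>sub\<close> says that no group element outside the bottom field
  has level below s, and b is one of level s. The first fact bounds all distances from below, the
  single codeword given by b bounds the minimum from above.\<close>

lemma min_dist_bounds:
  assumes \<beta>: "\<beta> \<noteq> 0" and s: "1 \<le> s" "s \<le> k"
    and sub: "cyc_group \<beta> \<inter> Fld s \<subseteq> Fld 1"
    and b: "b \<in> cyc_group \<beta>" "b \<in> Fld (s + 1)" "b \<notin> Fld s"
  shows "2 * m s * (Lq m (s + 1) - 1) + Mq m s \<le> min_dist q (orbit \<beta> Flag)"
    and "min_dist q (orbit \<beta> Flag) \<le> m s * ((Lq m (s + 1))\<^sup>2 div 2) + Mq m s"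
proof -
  define X where "X = {flag_dist q F G | F G. F \<in> orbit \<beta> Flag \<and> G \<in> orbit \<beta> Flag \<and> F \<noteq> G}"
  have "finite (orbit \<beta> Flag)" unfolding orbit_eq_image[OF \<beta>] by simp
  then have "finite ((\<lambda>(F, G). flag_dist q F G) ` (orbit \<beta> Flag \<times> orbit \<beta> Flag))" by simp
  then have fin: "finite X"
    by (rule rev_finite_subset) (auto simp: X_def)
  have one: "1 \<in> cyc_group \<beta>" unfolding cyc_group_eq_powers by (rule range_eqI[of _ _ 0]) simp
  have stable: "flag_dist q Flag Flag = 0"
    using flag_dist_Flag[of 1] level_sum_inside[of _ 1] by (simp add: flag_mult_1 subfld_def)
  \<comment> \<open>Positivity of the lower bound shows that b really moves the flag, so the set
    under Min is nonempty.\<close>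
  have "0 < 2 * m s * (Lq m (s + 1) - 1)"
    using m_pos[of s] Lq_ge_2[of s] s by simp
  then have "Flag \<noteq> flag_mult Flag b"
    using flag_dist_bounds(1)[OF s b(2,3)] stable by auto
  moreover have "Flag \<in> orbit \<beta> Flag" "flag_mult Flag b \<in> orbit \<beta> Flag"
    unfolding orbit_eq_image[OF \<beta>] using one b(1) flag_mult_1[of Flag] by (auto intro: rev_image_eqI)
  ultimately have in_X: "flag_dist q Flag (flag_mult Flag b) \<in> X"
    unfolding X_def by blast
  have "2 * m s * (Lq m (s + 1) - 1) + Mq m s \<le> d" if d: "d \<in> X" for d
  proof -
    obtain x y where xy: "x \<in> cyc_group \<beta>" "y \<in> cyc_group \<beta>" "flag_mult Flag x \<noteq> flag_mult Flag y"
      "d = flag_dist q (flag_mult Flag x) (flag_mult Flag y)"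
      using d unfolding X_def orbit_eq_image[OF \<beta>] by blast
    have nz: "x \<noteq> 0" "y \<noteq> 0" using cyc_group_nonzero xy(1,2) \<beta> by auto
    define c where "c = y / x"
    have c: "c \<in> cyc_group \<beta>" unfolding c_def using cyc_group_divide xy(1,2) \<beta> by blast
    have y: "flag_mult Flag y = flag_mult (flag_mult Flag c) x"
      using nz unfolding c_def by (simp add: flag_mult_mult)
    have "c \<noteq> 0" using nz unfolding c_def by simp
    then have c1: "c \<notin> Fld 1" using flag_mult_stable[of c] xy(3) y by auto
    then obtain t where t: "1 \<le> t" "t \<le> k" "c \<in> Fld (t + 1)" "c \<notin> Fld t"
      by (rule exists_level)
    have "s \<le> t"
    proof (rule ccontr)
      assume "\<not> s \<le> t"
      then have "c \<in> Fld s" using Fld_mono[of "t + 1" s] t s by auto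
      then show False using sub c c1 by blast
    qed
    then show ?thesis
      using lower_bound_mono[of s t] flag_dist_bounds(1)[OF t] s t nz
      unfolding xy(4) flag_dist_translate[OF nz(1)] c_def[symmetric] by linarith
  qed
  then show "2 * m s * (Lq m (s + 1) - 1) + Mq m s \<le> min_dist q (orbit \<beta> Flag)"
    unfolding min_dist_def X_def[symmetric] using Min_in[OF fin] in_X by blast
  have "min_dist q (orbit \<beta> Flag) \<le> flag_dist q Flag (flag_mult Flag b)"
    unfolding min_dist_def X_def[symmetric] using fin in_X by (rule Min_le)
  also note flag_dist_bounds(2)[OF s b(2,3)]
  finally show "min_dist q (orbit \<beta> Flag) \<le> m s * ((Lq m (s + 1))\<^sup>2 div 2) + Mq m s" .
qed

end

theorem mainTheorem12:
  fixes q n k :: nat and m :: "nat \<Rightarrow> nat" and \<alpha> \<beta> :: "'a::{field,finite}"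
  assumes q: "primepow q"
    and card: "card (UNIV::'a set) = q ^ n"
    and prim: "\<forall>x::'a. x \<noteq> 0 \<longrightarrow> (\<exists>j. x = \<alpha> ^ j)"
    and k: "1 \<le> k"
    and m1: "0 < m 1"
    and mn: "m (k+1) = n"
    and mmono: "\<forall>i. 1 \<le> i \<and> i \<le> k \<longrightarrow> m i < m (i+1)"
    and mdvd: "\<forall>i. 1 \<le> i \<and> i \<le> k \<longrightarrow> m i dvd m (i+1)"
    and beta: "\<beta> \<noteq> 0" "\<beta> \<notin> subfld (q ^ m 1)"
  shows
   "(cyc_group \<beta> \<inter> (subfld (q ^ m 1) - {0}) = cyc_group \<beta> \<inter> (subfld (q ^ m k) - {0}) \<longrightarrow>
      2 * m k * (Lq m (k+1) - 1) + Mq m k \<le> min_dist q (orbit \<beta> (weaved_flag q n m k \<alpha>)) \<and>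
      min_dist q (orbit \<beta> (weaved_flag q n m k \<alpha>)) \<le> m k * (Lq m (k+1) ^ 2 div 2) + Mq m k)
    \<and>
    (\<forall>i. cyc_group \<beta> \<inter> (subfld (q ^ m 1) - {0}) \<noteq> cyc_group \<beta> \<inter> (subfld (q ^ m k) - {0})
       \<and> 1 < i \<and> i \<le> k
       \<and> cyc_group \<beta> \<inter> (subfld (q ^ m 1) - {0}) \<subset> cyc_group \<beta> \<inter> (subfld (q ^ m i) - {0})
       \<and> (\<forall>i'. 1 < i' \<and> i' < i \<longrightarrow>
             \<not> (cyc_group \<beta> \<inter> (subfld (q ^ m 1) - {0}) \<subset> cyc_group \<beta> \<inter> (subfld (q ^ m i') - {0})))
     \<longrightarrow>
      2 * m (i-1) * (Lq m i - 1) + Mq m (i-1) \<le> min_dist q (orbit \<beta> (weaved_flag q n m k \<alpha>)) \<and>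
      min_dist q (orbit \<beta> (weaved_flag q n m k \<alpha>)) \<le> m (i-1) * (Lq m i ^ 2 div 2) + Mq m (i-1))"
proof -
  \<comment> \<open>A strictly increasing chain from m_1 >= 1 gives n >= k + 1 >= 2, as required to
    exclude \<alpha> = 0.\<close>
  have m_gt: "Suc i \<le> m (Suc i)" if "i \<le> k" for i
    using that
  proof (induction i)
    case 0 then show ?case using m1 by simp
  next
    case (Suc i) then show ?case using mmono[rule_format, of "Suc i"] by simp
  qed
  have "1 < n" using m_gt[of k] k mn by simp
  then interpret weaved_setup q n \<alpha> k m
    using q card prim k m1 mn mmono mdvd by unfold_locales auto
  have beta_in: "\<beta> \<in> cyc_group \<beta>"
    unfolding cyc_group_eq_powers by (rule range_eqI[of _ _ 1]) simp
  \<comment> \<open>Powers of \<beta> are never 0, so removing 0 from the fields changes nothing. As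
    \<beta> is outside \<open>Fld 1\<close>, the equality keeps it outside \<open>Fld k\<close>, and
    \<beta> itself is the witness of level k.\<close>
  have case1: "cyc_group \<beta> \<inter> Fld k \<subseteq> Fld 1 \<and> \<beta> \<in> Fld (k + 1) \<and> \<beta> \<notin> Fld k"
    if eq: "cyc_group \<beta> \<inter> (Fld 1 - {0}) = cyc_group \<beta> \<inter> (Fld k - {0})"
    using eq beta beta_in cyc_group_nonzero[of _ \<beta>] Fld_top by blast
  \<comment> \<open>For i - 1 > 1 the inclusion at i - 1 is not strict by minimality of i, and since
    the fields are nested it is an equality.\<close>
  have case2: "cyc_group \<beta> \<inter> Fld (i - 1) \<subseteq> Fld 1"
    if i: "1 < i" "i \<le> k" and min: "\<forall>i'. 1 < i' \<and> i' < i \<longrightarrow>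
        \<not> (cyc_group \<beta> \<inter> (Fld 1 - {0}) \<subset> cyc_group \<beta> \<inter> (Fld i' - {0}))" for i
  proof (cases "i - 1 = 1")
    case False
    then have "\<not> (cyc_group \<beta> \<inter> (Fld 1 - {0}) \<subset> cyc_group \<beta> \<inter> (Fld (i - 1) - {0}))"
      using i min by simp
    moreover have "Fld 1 \<subseteq> Fld (i - 1)" using i by (intro Fld_mono) simp_all
    ultimately show ?thesis using cyc_group_nonzero[of _ \<beta>] beta(1) by blast
  qed simp
  show ?thesis
  proof (intro conjI allI impI; (elim conjE)?)
    assume eq: "cyc_group \<beta> \<inter> (Fld 1 - {0}) = cyc_group \<beta> \<inter> (Fld k - {0})"
    show "2 * m k * (Lq m (k+1) - 1) + Mq m k \<le> min_dist q (orbit \<beta> Flag)"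
      "min_dist q (orbit \<beta> Flag) \<le> m k * (Lq m (k+1) ^ 2 div 2) + Mq m k"
      using min_dist_bounds[OF beta(1) k order_refl _ beta_in] case1[OF eq] by blast+
  next
    fix i
    assume i: "1 < i" "i \<le> k"
      and less: "cyc_group \<beta> \<inter> (Fld 1 - {0}) \<subset> cyc_group \<beta> \<inter> (Fld i - {0})"
      and min: "\<forall>i'. 1 < i' \<and> i' < i \<longrightarrow>
        \<not> (cyc_group \<beta> \<inter> (Fld 1 - {0}) \<subset> cyc_group \<beta> \<inter> (Fld i' - {0}))"
    note sub = case2[OF i min]
    from less obtain b where "b \<in> cyc_group \<beta>" "b \<in> Fld i" "b \<notin> Fld 1"
      using cyc_group_nonzero[of _ \<beta>] beta(1) by blast
    \<comment> \<open>An element of \<open>Fld i\<close> outside \<open>Fld 1\<close> cannot lie in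
      \<open>Fld (i - 1)\<close> by \<open>sub\<close>, so its level is exactly i - 1.\<close>
    then have b: "b \<in> cyc_group \<beta>" "b \<in> Fld (i - 1 + 1)" "b \<notin> Fld (i - 1)"
      using sub i by auto
    have s: "1 \<le> i - 1" "i - 1 \<le> k" "i - 1 + 1 = i" using i by simp_all
    show "2 * m (i-1) * (Lq m i - 1) + Mq m (i-1) \<le> min_dist q (orbit \<beta> Flag)"
      "min_dist q (orbit \<beta> Flag) \<le> m (i-1) * (Lq m i ^ 2 div 2) + Mq m (i-1)"
      using min_dist_bounds[OF beta(1) s(1,2) sub b] unfolding s(3) by blast+
  qed
qed

end
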